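(* Let $\mathcal H$ be a real Hilbert space, $A:\mathcal H\to\mathcal H$ single-valued and continuously differentiable, $B:\mathcal H\rightrightarrows 2^{\mathcal H}$ maximal monotone, and suppose the solution set $\mathcal S=\{x: 0\in (A+B)(x)\}$ is nonempty. Consider a sequence $\{x_t\}$ generated by the inexact damped Newton-like scheme described in the context with parameters $c>0$ and $\nu,\rho\ge 0$. Assume that for some $\epsilon>0$, $\kappa>0$ and $q>0$ the error bound $$\operatorname{dist}(x,\mathcal S)\le \kappa\, r(x)^q\qquad \forall x\in V:=\{x : r(x)\le \epsilon\}$$ holds, and that within $V$, $A$ is $L$-Lipschitz continuous for some $L\ge 0$ and $\nabla A$ is $p$-Hölder continuous for some $p\in(0,1]$ (i.e. $\|\nabla A(x)-\nabla A(y)\|\le \zeta\|x-y\|^p$ for all $x,y\in V$, for some $\zeta\ge0$). Suppose that $$(1+\rho)q>1,\qquad (1+p)q>1,\qquad (q+pq-\rho)(1+p)>1 .$$ Then, if $r_0$ is sufficiently small, $\{r_t\}$ and $\{d_t\}$ converge $Q$-superlinearly to $0$ according to $$r_{t+1}=O\left(r_t^{1+s}\right),\qquad d_{t+1}=O\left(d_t^{1+s}\right),$$ where $$s:=\min\{(1+\rho)q,\ (1+p)q,\ (q+pq-\rho)(1+p)\}-1>0 .$$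
   Context: Notation: $\mathrm{Id}$ is the identity on $\mathcal H$; $R(x):=x-(\mathrm{Id}+B)^{-1}(\mathrm{Id}-A)(x)$, $r(x):=\|R(x)\|$, so that $\mathcal S=\{x: R(x)=0\}$; $\operatorname{dist}(x,\mathcal S)$ is the distance from $x$ to $\mathcal S$. Along a sequence $\{x_t\}$: $r_t:=r(x_t)$, $d_t:=\operatorname{dist}(x_t,\mathcal S)$. The scheme: at iterate $x_t$, put $\mu_t:=c\,r(x_t)^\rho$, and $H_t:=\mu_t\mathrm{Id}+J_t$, where $J_t$ is a bounded linear operator on $\mathcal H$ that is positive semidefinite ($\langle J_t v,v\rangle\ge 0$ for all $v$) but possibly non-Hermitian and satisfies $\|J_t-\nabla A(x_t)\|=O(r(x_t)^\theta)$ for some $\theta\ge\rho$ (with constant independent of $t$). Define the subproblem residual $$\hat r_t(x):=\left\|x-(\mathrm{Id}+B)^{-1}\big((\mathrm{Id}-H_t)(x)+(H_t-A)(x_t)\big)\right\|,$$ which vanishes at the exact step $(H_t+B)^{-1}(H_t-A)(x_t)$. The next iterate $x_{t+1}$ is any point satisfying $\hat r_t(x_{t+1})\le \nu\, r(x_t)^{1+\rho}$. The iteration is stopped if $r(x_t)=0$ (then $x_t\in\mathcal S$), so $r(x_t)>0$ whenever a step is taken. $\sigma_t=O(\tau_t)$ means $\sigma_t\le\beta\tau_t$ for some $\beta>0$ independent of $t$, for all $t$ sufficiently large.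
   Formalization: The bound on ‖J_t − ∇A(x_t)‖ by a constant times r(x_t)^θ is required at every step taken, with a constant fixed before "r_0 sufficiently small" is chosen; if it held only for all large t, the claim would be false. *)

theory Defs
  imports "HOL-Analysis.Analysis" "HOL-Library.Landau_Symbols"
begin

text \<open>A set-valued operator on a real Hilbert space is a function of type \<open>'a \<Rightarrow> 'a set\<close>.\<close>

definition monotone_operator :: "('a::real_inner \<Rightarrow> 'a set) \<Rightarrow> bool" where
  "monotone_operator B \<longleftrightarrow>
     (\<forall>x y. \<forall>u\<in>B x. \<forall>v\<in>B y. (u - v) \<bullet> (x - y) \<ge> 0)"

definition maximal_monotone :: "('a::real_inner \<Rightarrow> 'a set) \<Rightarrow> bool" where
  "maximal_monotone B \<longleftrightarrow>
     monotone_operator B \<and>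
     (\<forall>B'. monotone_operator B' \<and> (\<forall>x. B x \<subseteq> B' x) \<longrightarrow> B' = B)"

definition solution_set :: "('a::real_inner \<Rightarrow> 'a) \<Rightarrow> ('a \<Rightarrow> 'a set) \<Rightarrow> 'a set" where
  "solution_set A B = {x. 0 \<in> {A x + b | b. b \<in> B x}}"

text \<open>The value at \<open>y\<close> of \<open>(Id + B)\<inverse>\<close>. For maximal monotone \<open>B\<close> on a Hilbert space the point
  selected here exists by Minty's theorem, and it is unique by monotonicity.\<close>

definition resolvent :: "('a::real_inner \<Rightarrow> 'a set) \<Rightarrow> 'a \<Rightarrow> 'a" where
  "resolvent B y = (THE x. y \<in> {x + b | b. b \<in> B x})"

definition residual_map :: "('a::real_inner \<Rightarrow> 'a) \<Rightarrow> ('a \<Rightarrow> 'a set) \<Rightarrow> 'a \<Rightarrow> 'a" where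
  "residual_map A B x = x - resolvent B (x - A x)"

definition residual :: "('a::real_inner \<Rightarrow> 'a) \<Rightarrow> ('a \<Rightarrow> 'a set) \<Rightarrow> 'a \<Rightarrow> real" where
  "residual A B x = norm (residual_map A B x)"

definition positive_semidefinite :: "('a::real_inner \<Rightarrow>\<^sub>L 'a) \<Rightarrow> bool" where
  "positive_semidefinite J \<longleftrightarrow> (\<forall>v. J v \<bullet> v \<ge> 0)"

text \<open>\<open>H\<^sub>t = \<mu>\<^sub>t Id + J\<^sub>t\<close> with \<open>\<mu>\<^sub>t = c r(x\<^sub>t)\<^sup>\<rho>\<close>, where \<open>xt\<close> and \<open>Jt\<close> stand for \<open>x\<^sub>t\<close> and \<open>J\<^sub>t\<close>.
  Note that \<open>0 powr 0 = 0\<close>; this operator is only used at points with positive residual.\<close>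

definition damped_operator ::
    "('a::real_inner \<Rightarrow> 'a) \<Rightarrow> ('a \<Rightarrow> 'a set) \<Rightarrow> real \<Rightarrow> real \<Rightarrow> 'a \<Rightarrow> ('a \<Rightarrow>\<^sub>L 'a) \<Rightarrow> ('a \<Rightarrow>\<^sub>L 'a)" where
  "damped_operator A B c \<rho> xt Jt = (c * residual A B xt powr \<rho>) *\<^sub>R id_blinfun + Jt"

definition subproblem_residual ::
    "('a::real_inner \<Rightarrow> 'a) \<Rightarrow> ('a \<Rightarrow> 'a set) \<Rightarrow> ('a \<Rightarrow>\<^sub>L 'a) \<Rightarrow> 'a \<Rightarrow> 'a \<Rightarrow> real" where
  "subproblem_residual A B Ht xt x =
     norm (x - resolvent B ((x - Ht x) + (Ht xt - A xt)))"

text \<open>\<open>DA\<close> is the derivative of \<open>A\<close>, and \<open>C\<close> is the constant in \<open>\<parallel>J\<^sub>t - \<nabla>A(x\<^sub>t)\<parallel> = O(r(x\<^sub>t)\<^sup>\<theta>)\<close>;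
  that bound is required at every step taken. Stopping at an iterate with zero residual is encoded
  by keeping the sequence constant from there on; nothing is required of \<open>J\<^sub>t\<close> at such \<open>t\<close>.\<close>

definition inexact_newton_sequence ::
    "('a::real_inner \<Rightarrow> 'a) \<Rightarrow> ('a \<Rightarrow> 'a \<Rightarrow>\<^sub>L 'a) \<Rightarrow> ('a \<Rightarrow> 'a set) \<Rightarrow>
     real \<Rightarrow> real \<Rightarrow> real \<Rightarrow> real \<Rightarrow> real \<Rightarrow> (nat \<Rightarrow> 'a \<Rightarrow>\<^sub>L 'a) \<Rightarrow> (nat \<Rightarrow> 'a) \<Rightarrow> bool" where
  "inexact_newton_sequence A DA B c \<nu> \<rho> \<theta> C J x \<longleftrightarrow>
     (\<forall>t. if residual A B (x t) = 0 then x (Suc t) = x t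
          else positive_semidefinite (J t) \<and>
               norm (J t - DA (x t)) \<le> C * residual A B (x t) powr \<theta> \<and>
               subproblem_residual A B (damped_operator A B c \<rho> (x t) (J t)) (x t) (x (Suc t))
                 \<le> \<nu> * residual A B (x t) powr (1 + \<rho>))"

text \<open>Using \<open>o\<close> instead of the limit of \<open>\<sigma>\<^sub>t\<^sub>+\<^sub>1 / \<sigma>\<^sub>t\<close> keeps the notion meaningful
  for sequences that reach 0.\<close>

definition Q_superlinear_to_zero :: "(nat \<Rightarrow> real) \<Rightarrow> bool" where
  "Q_superlinear_to_zero \<sigma> \<longleftrightarrow> \<sigma> \<longlonglongrightarrow> 0 \<and> (\<lambda>t. \<sigma> (Suc t)) \<in> o(\<sigma>)"

end

theory Submission
  imports Defs
begin

text \<open>Let \<open>r\<close> and \<open>d\<close> be the residual of the current iterate and its distance to the solution set, and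
  let \<open>h\<close> be the step taken. Testing the inclusion solved (inexactly) by the next iterate against a
  nearly closest solution and using that \<open>H\<^sub>t - \<mu>\<^sub>t Id\<close> is positive semidefinite gives
  \<open>\<parallel>h\<parallel> = O(d + d\<^bsup>1+p\<^esup> r\<^bsup>-\<rho>\<^esup>)\<close>, while nonexpansiveness of the resolvent gives
  \<open>r\<^sub>n\<^sub>e\<^sub>w = O(r\<^bsup>1+\<rho>\<^esup> + r\<^bsup>\<rho>\<^esup>\<parallel>h\<parallel> + \<parallel>h\<parallel>\<^bsup>1+p\<^esup>)\<close>. Since \<open>r = O(d)\<close> and \<open>d \<le> \<kappa> r\<^bsup>q\<^esup>\<close>, everything is
  expressible in \<open>d\<close>, namely \<open>r\<^sub>n\<^sub>e\<^sub>w = O(d\<^bsup>\<sigma>\<^esup>)\<close> with \<open>\<sigma> = (1 + s) / q\<close>. One more use of the error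
  bound, at the old point or at the new one, turns this into both rates.\<close>

section \<open>Resolvents of maximal monotone operators\<close>

text \<open>For a fixed graph point, monotonicity becomes an affine inequality in
  \<open>(u, v, w)\<close> once the inner product is replaced by the third coordinate, so it passes
  to the convex hull. Doing this in one argument and then in the other lets a hull point be paired
  with itself, which gives \<open>2 * (w - u \<bullet> v) \<ge> 0\<close>.\<close>

lemma inner_le_of_monotone_convex_hull:
  fixes G :: "('a::real_inner \<times> 'a) set"
  assumes mono: "\<And>u v u' v'. (u, v) \<in> G \<Longrightarrow> (u', v') \<in> G \<Longrightarrow> (v - v') \<bullet> (u - u') \<ge> 0"
    and hull: "(u, v, w) \<in> convex hull ((\<lambda>(u, v). (u, v, u \<bullet> v)) ` G)"
  shows "u \<bullet> v \<le> w"
proof -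
  let ?T = "(\<lambda>(u, v). (u, v, u \<bullet> v)) ` G"
  have conv: "convex {(u0, v0, w0). w - u \<bullet> v0 - u0 \<bullet> v + w0 \<ge> (0::real)}" for u v :: 'a and w
  proof -
    have "{(u0, v0, w0). w - u \<bullet> v0 - u0 \<bullet> v + w0 \<ge> (0::real)} = {p. (v, u, -1) \<bullet> p \<le> w}"
      by (auto simp: inner_commute)
    then show ?thesis
      by (simp add: convex_halfspace_le)
  qed
  have 1: "w1 - u1 \<bullet> v0 - u0 \<bullet> v1 + u0 \<bullet> v0 \<ge> 0"
    if "(u0, v0) \<in> G" "(u1, v1, w1) \<in> convex hull ?T" for u0 v0 u1 v1 w1
  proof -
    have "?T \<subseteq> {(u2, v2, w2). u0 \<bullet> v0 - u0 \<bullet> v2 - u2 \<bullet> v0 + w2 \<ge> 0}"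
      using mono[OF _ that(1)] by (auto simp: inner_simps inner_commute algebra_simps)
    from hull_minimal[of _ _ convex, OF this conv] that(2) show ?thesis
      by (auto simp: algebra_simps)
  qed
  have "?T \<subseteq> {(u2, v2, w2). w - u \<bullet> v2 - u2 \<bullet> v + w2 \<ge> 0}"
    using 1[OF _ hull] by auto
  from hull_minimal[of _ _ convex, OF this conv] hull show ?thesis
    by auto
qed

text \<open>A minimizing sequence of the strongly convex function \<open>\<parallel>z\<parallel>\<^sup>2 + w\<close> is Cauchy in the first component,
  and the asserted inequality is the first-order condition at its limit. No convergence of the second
  component is needed.\<close>

lemma minimizer_variational_inequality:
  fixes K :: "('a::{real_inner, complete_space} \<times> real) set"
  assumes K: "convex K" "K \<noteq> {}" and nonneg: "\<And>z w. (z, w) \<in> K \<Longrightarrow> (norm z)\<^sup>2 + w \<ge> 0"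
  shows "\<exists>x. \<forall>(a, b)\<in>K. 2 * (x \<bullet> a) - (norm x)\<^sup>2 + b \<ge> 0"
proof -
  define g :: "'a \<times> real \<Rightarrow> real" where "g k = (norm (fst k))\<^sup>2 + snd k" for k
  define m where "m = Inf (g ` K)"
  have bdd: "bdd_below (g ` K)"
    using nonneg by (intro bdd_belowI[of _ 0]) (auto simp: g_def)
  have m_le: "m \<le> g k" if "k \<in> K" for k
    unfolding m_def using that bdd by (intro cINF_lower)
  have "m \<ge> 0"
    unfolding m_def using K nonneg by (intro cINF_greatest) (auto simp: g_def)
  have "\<exists>k\<in>K. g k < m + inverse (Suc n)" for n
    using cInf_lessD[of "g ` K" "m + inverse (Suc n)"] K by (auto simp: m_def)
  then obtain k where k: "\<And>n. k n \<in> K" "\<And>n. g (k n) < m + inverse (Suc n)"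
    by metis
  define z where "z n = fst (k n)" for n
  \<comment> \<open>Strong convexity as an identity: the second component is linear and contributes
    no defect. The case \<open>t = 1/2\<close> makes the minimizing sequence Cauchy; small
    \<open>t\<close> gives the variational inequality.\<close>
  have g_comb: "g ((1 - t) *\<^sub>R k1 + t *\<^sub>R k2) =
      (1 - t) * g k1 + t * g k2 - t * (1 - t) * (norm (fst k1 - fst k2))\<^sup>2" for t k1 k2
    unfolding g_def power2_norm_eq_inner
    by (simp add: inner_simps inner_commute[of "fst k2" "fst k1"]) algebra
  have conv: "(1 - t) *\<^sub>R k1 + t *\<^sub>R k2 \<in> K" if "k1 \<in> K" "k2 \<in> K" "0 \<le> t" "t \<le> 1" for k1 k2 and t :: real
    using K(1) that unfolding convex_alt by blast
  have close: "(norm (z i - z j))\<^sup>2 \<le> 2 * (inverse (Suc i) + inverse (Suc j))" for i j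
  proof -
    have "(1 - 1/2) *\<^sub>R k i + (1/2::real) *\<^sub>R k j \<in> K"
      by (intro conv k) auto
    from m_le[OF this] k(2)[of i] k(2)[of j] show ?thesis
      unfolding g_comb z_def by (simp del: of_nat_Suc)
  qed
  have "Cauchy z"
  proof (rule metric_CauchyI)
    fix e :: real assume "e > 0"
    then have "e\<^sup>2 / 4 > 0" by simp
    then obtain N where N: "inverse (real (Suc N)) < e\<^sup>2 / 4"
      using reals_Archimedean by blast
    have "dist (z i) (z j) < e" if "i \<ge> N" "j \<ge> N" for i j
    proof -
      have *: "inverse (real (Suc i)) \<le> inverse (real (Suc N))"
           "inverse (real (Suc j)) \<le> inverse (real (Suc N))"
        using that by (intro le_imp_inverse_le; simp)+
      have "(norm (z i - z j))\<^sup>2 \<le> 2 * (inverse (Suc N) + inverse (Suc N))"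
        by (rule order_trans[OF close]) (intro mult_left_mono add_mono *, simp)
      also have "\<dots> < 2 * (e\<^sup>2 / 4 + e\<^sup>2 / 4)"
        by (intro mult_strict_left_mono add_strict_mono N) simp
      finally have "(norm (z i - z j))\<^sup>2 < e\<^sup>2" by simp
      then show ?thesis
        using \<open>e > 0\<close> by (simp add: dist_norm power2_less_imp_less)
    qed
    then show "\<exists>M. \<forall>i\<ge>M. \<forall>j\<ge>M. dist (z i) (z j) < e" by blast
  qed
  then obtain x where x: "z \<longlonglongrightarrow> x"
    using Cauchy_convergent convergent_def by blast
  have inv0: "(\<lambda>n. inverse (real (Suc n))) \<longlonglongrightarrow> 0"
    by (rule LIMSEQ_inverse_real_of_nat)
  have "2 * (x \<bullet> a) - (norm x)\<^sup>2 + b \<ge> 0" if ab: "(a, b) \<in> K" for a b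
  proof -
    \<comment> \<open>First \<open>n\<close> tends to infinity with \<open>t\<close> fixed, so the
      excess \<open>inverse (Suc n)\<close> vanishes in spite of the division by \<open>t\<close>;
      only afterwards does \<open>t\<close> tend to 0.\<close>
    have step: "m \<le> 2 * (x \<bullet> a) - (norm x)\<^sup>2 + b + t * (norm (x - a))\<^sup>2" if t: "0 < t" "t < 1" for t
    proof -
      have ineq: "m / t \<le> (m + inverse (Suc n)) * (1 - t) / t + g (a, b) - (1 - t) * (norm (z n - a))\<^sup>2" for n
      proof -
        have "(1 - t) *\<^sub>R k n + t *\<^sub>R (a, b) \<in> K"
          using t by (intro conv k ab) auto
        from m_le[OF this] have "m \<le> (1 - t) * g (k n) + t * g (a, b) - t * (1 - t) * (norm (z n - a))\<^sup>2"
          unfolding g_comb z_def by simp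
        also have "\<dots> \<le> (1 - t) * (m + inverse (Suc n)) + t * g (a, b) - t * (1 - t) * (norm (z n - a))\<^sup>2"
          using k(2)[of n] t by (intro diff_right_mono add_right_mono mult_left_mono) auto
        finally have "m / t \<le> ((1 - t) * (m + inverse (Suc n)) + t * g (a, b) - t * (1 - t) * (norm (z n - a))\<^sup>2) / t"
          using t by (intro divide_right_mono) auto
        also have "\<dots> = (m + inverse (Suc n)) * (1 - t) / t + g (a, b) - (1 - t) * (norm (z n - a))\<^sup>2"
          using t by (simp add: add_divide_distrib diff_divide_distrib mult.commute del: of_nat_Suc)
        finally show ?thesis .
      qed
      have "(\<lambda>n. (m + inverse (Suc n)) * (1 - t) / t + g (a, b) - (1 - t) * (norm (z n - a))\<^sup>2)
          \<longlonglongrightarrow> (m + 0) * (1 - t) / t + g (a, b) - (1 - t) * (norm (x - a))\<^sup>2"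
        using t by (intro tendsto_intros inv0 x) auto
      from LIMSEQ_le_const[OF this, of "m / t"] ineq
      have "m / t \<le> m * (1 - t) / t + g (a, b) - (1 - t) * (norm (x - a))\<^sup>2"
        by auto
      then have "m \<le> m / t - m * (1 - t) / t \<Longrightarrow> m \<le> g (a, b) - (1 - t) * (norm (x - a))\<^sup>2"
        by linarith
      moreover have "m / t - m * (1 - t) / t = m"
        using t by (simp add: field_simps)
      ultimately have "m \<le> g (a, b) - (1 - t) * (norm (x - a))\<^sup>2"
        by simp
      then show ?thesis
        by (simp add: g_def power2_norm_eq_inner inner_simps inner_commute algebra_simps)
    qed
    have "((\<lambda>t. 2 * (x \<bullet> a) - (norm x)\<^sup>2 + b + t * (norm (x - a))\<^sup>2) \<longlongrightarrow>
        2 * (x \<bullet> a) - (norm x)\<^sup>2 + b + 0 * (norm (x - a))\<^sup>2) (at_right 0)"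
      by (intro tendsto_intros)
    moreover have "\<forall>\<^sub>F t in at_right (0::real). m \<le> 2 * (x \<bullet> a) - (norm x)\<^sup>2 + b + t * (norm (x - a))\<^sup>2"
      using step by (auto simp: eventually_at_right_field intro!: exI[of _ 1])
    ultimately have "m \<le> 2 * (x \<bullet> a) - (norm x)\<^sup>2 + b + 0 * (norm (x - a))\<^sup>2"
      using tendsto_lowerbound[of _ _ "at_right (0::real)" m] by simp
    with \<open>m \<ge> 0\<close> show ?thesis by simp
  qed
  then show ?thesis by blast
qed

text \<open>After translating by \<open>y\<close>, the point \<open>x\<close> is sought by minimizing \<open>\<parallel>(u - v)/2\<parallel>\<^sup>2 + w\<close> over the convex hull of
  the points \<open>(u, v, u \<bullet> v)\<close> of the graph, which is the dual of making \<open>(u - x) \<bullet> (v + x) \<ge> 0\<close> hold for the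
  whole graph. Monotonicity bounds it below by \<open>\<parallel>(u + v)/2\<parallel>\<^sup>2\<close>.\<close>

lemma minty:
  fixes B :: "'a::{real_inner, complete_space} \<Rightarrow> 'a set"
  assumes max: "maximal_monotone B"
  shows "\<exists>x. y - x \<in> B x"
proof (cases "\<exists>u v. v \<in> B u")
  case True
  have monoB: "(v - v') \<bullet> (u - u') \<ge> 0" if "v \<in> B u" "v' \<in> B u'" for u v u' v'
    using max that by (auto simp: maximal_monotone_def monotone_operator_def)
  define G where "G = {(u, v). v + y \<in> B u}"
  define T where "T = (\<lambda>(u, v). (u, v, u \<bullet> v)) ` G"
  define F :: "'a \<times> 'a \<times> real \<Rightarrow> 'a \<times> real" where "F = (\<lambda>(u, v, w). ((1/2) *\<^sub>R (u - v), w))"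
  have lin: "linear F"
    by (intro linearI) (auto simp: F_def algebra_simps)
  have monoG: "(v - v') \<bullet> (u - u') \<ge> 0" if "(u, v) \<in> G" "(u', v') \<in> G" for u v u' v'
    using monoB[of "v + y" u "v' + y" u'] that by (auto simp: G_def)
  have "\<exists>x. \<forall>(a, b)\<in>F ` (convex hull T). 2 * (x \<bullet> a) - (norm x)\<^sup>2 + b \<ge> 0"
  proof (rule minimizer_variational_inequality)
    show "convex (F ` (convex hull T))"
      by (intro convex_linear_image lin) simp
    obtain u v where "v \<in> B u" using True by blast
    then have "(u, v - y) \<in> G" by (simp add: G_def)
    then show "F ` (convex hull T) \<noteq> {}"
      by (auto simp: T_def)
    fix z w assume "(z, w) \<in> F ` (convex hull T)"
    then obtain u v where uv: "(u, v, w) \<in> convex hull T" "z = (1/2) *\<^sub>R (u - v)"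
      by (auto simp: F_def)
    have "u \<bullet> v \<le> w"
      using uv(1) monoG unfolding T_def by (rule inner_le_of_monotone_convex_hull[rotated])
    moreover have "(norm z)\<^sup>2 + u \<bullet> v = (norm ((1/2) *\<^sub>R (u + v)))\<^sup>2"
      unfolding uv(2) by (simp add: power2_norm_eq_inner inner_simps inner_commute algebra_simps power_mult_distrib)
    ultimately show "(norm z)\<^sup>2 + w \<ge> 0"
      by (smt (verit) zero_le_power2)
  qed
  then obtain x where x: "\<And>a b. (a, b) \<in> F ` (convex hull T) \<Longrightarrow> 2 * (x \<bullet> a) - (norm x)\<^sup>2 + b \<ge> 0"
    by blast
  \<comment> \<open>At a graph point the variational inequality expands to exactly this relation.
    Hence the pair \<open>(x, y - x)\<close> can be adjoined to the graph without losing
    monotonicity, and maximality puts it there already.\<close>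
  have rel: "(v - (y - x)) \<bullet> (u - x) \<ge> 0" if "v \<in> B u" for u v
  proof -
    have "(u, v - y, u \<bullet> (v - y)) \<in> convex hull T"
      using that by (intro hull_inc) (force simp: T_def G_def)
    moreover have "F (u, v - y, u \<bullet> (v - y)) = ((1/2) *\<^sub>R (u - (v - y)), u \<bullet> (v - y))"
      by (simp add: F_def)
    ultimately have "((1/2) *\<^sub>R (u - (v - y)), u \<bullet> (v - y)) \<in> F ` (convex hull T)"
      by (metis imageI)
    from x[OF this] have "2 * (x \<bullet> ((1/2) *\<^sub>R (u - (v - y)))) - (norm x)\<^sup>2 + u \<bullet> (v - y) \<ge> 0"
      .
    then show ?thesis
      by (simp add: power2_norm_eq_inner inner_simps inner_commute algebra_simps)
  qed
  define B' where "B' = B(x := insert (y - x) (B x))"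
  have "monotone_operator B'"
    unfolding monotone_operator_def
  proof (intro allI ballI)
    fix u u' v v' assume "v \<in> B' u" "v' \<in> B' u'"
    then have *: "v \<in> B u \<or> u = x \<and> v = y - x" "v' \<in> B u' \<or> u' = x \<and> v' = y - x"
      by (auto simp: B'_def split: if_splits)
    have "(y - x - v') \<bullet> (x - u') = (v' - (y - x)) \<bullet> (u' - x)"
      by (simp add: inner_simps algebra_simps)
    with * rel[of v u] rel[of v' u'] monoB[of v u v' u'] show "(v - v') \<bullet> (u - u') \<ge> 0"
      by auto
  qed
  moreover have "\<forall>u. B u \<subseteq> B' u" by (auto simp: B'_def)
  ultimately have "B' = B"
    using max by (auto simp: maximal_monotone_def)
  moreover have "y - x \<in> B' x"
    by (simp add: B'_def)
  ultimately show ?thesis by auto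
next
  case False
  then have empty: "B u = {}" for u by blast
  \<comment> \<open>An empty graph is properly extended by the single pair \<open>(y, 0)\<close>, so
    this case contradicts maximality.\<close>
  define B' :: "'a \<Rightarrow> 'a set" where "B' = (\<lambda>x. if x = y then {0} else {})"
  have "monotone_operator B'"
    by (auto simp: monotone_operator_def B'_def split: if_splits)
  moreover have "\<forall>x. B x \<subseteq> B' x"
    using False by auto
  ultimately have "B' = B"
    using max by (auto simp: maximal_monotone_def)
  moreover have "y - y \<in> B' y"
    by (simp add: B'_def)
  ultimately show ?thesis by metis
qed

lemma resolvent_eqI:
  assumes "monotone_operator B" and "y - x \<in> B x"
  shows "resolvent B y = x"
  unfolding resolvent_def
proof (rule the_equality)
  show "y \<in> {x + b |b. b \<in> B x}"
    using assms(2) by (auto intro!: exI[of _ "y - x"])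
  fix x' assume "y \<in> {x' + b |b. b \<in> B x'}"
  then have "y - x' \<in> B x'" by auto
  with assms have "((y - x') - (y - x)) \<bullet> (x' - x) \<ge> 0"
    unfolding monotone_operator_def by blast
  then have "(x' - x) \<bullet> (x' - x) \<le> 0"
    by (simp add: inner_simps algebra_simps)
  then show "x' = x" by (metis inner_eq_zero_iff inner_ge_zero order_antisym eq_iff_diff_eq_0)
qed

lemma resolvent_mem:
  fixes B :: "'a::{real_inner, complete_space} \<Rightarrow> 'a set"
  assumes "maximal_monotone B"
  shows "y - resolvent B y \<in> B (resolvent B y)"
proof -
  obtain x where "y - x \<in> B x" using minty[OF assms] by blast
  moreover from this have "resolvent B y = x"
    using assms by (intro resolvent_eqI) (auto simp: maximal_monotone_def)
  ultimately show ?thesis by simp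
qed

text \<open>Monotonicity gives firm nonexpansiveness,
  \<open>?d \<bullet> ?d \<le> (y - y') \<bullet> ?d\<close>; Cauchy-Schwarz then cancels one factor
  \<open>norm ?d\<close>.\<close>

lemma resolvent_nonexpansive:
  fixes B :: "'a::{real_inner, complete_space} \<Rightarrow> 'a set"
  assumes "maximal_monotone B"
  shows "norm (resolvent B y - resolvent B y') \<le> norm (y - y')"
proof -
  let ?d = "resolvent B y - resolvent B y'"
  have "((y - resolvent B y) - (y' - resolvent B y')) \<bullet> ?d \<ge> 0"
    using assms resolvent_mem[OF assms] unfolding maximal_monotone_def monotone_operator_def by blast
  then have "?d \<bullet> ?d \<le> (y - y') \<bullet> ?d"
    by (simp add: inner_simps algebra_simps)
  also have "\<dots> \<le> norm (y - y') * norm ?d"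
    by (rule norm_cauchy_schwarz)
  finally have "norm ?d * norm ?d \<le> norm (y - y') * norm ?d"
    by (simp add: power2_norm_eq_inner[symmetric] power2_eq_square)
  then show ?thesis
    by (cases "norm ?d = 0") auto
qed

section \<open>The residual near the solution set\<close>

text \<open>The quantitative bounds are available only where the residual is at most \<epsilon>. The
  smallness conditions in the lemmas below keep the points and segments in question inside that
  set.\<close>

locale hoelder_error_bound =
  fixes A :: "'a::{real_inner, complete_space} \<Rightarrow> 'a"
    and DA :: "'a \<Rightarrow> 'a \<Rightarrow>\<^sub>L 'a"
    and B :: "'a \<Rightarrow> 'a set"
    and \<epsilon> \<kappa> q L p \<zeta> :: real
  assumes deriv: "\<And>x. (A has_derivative blinfun_apply (DA x)) (at x)"
    and max_mono: "maximal_monotone B"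
    and sol_nonempty: "solution_set A B \<noteq> {}"
    and eps_pos: "\<epsilon> > 0" and kappa_pos: "\<kappa> > 0" and q_pos: "q > 0"
    and error_bound: "\<And>x. residual A B x \<le> \<epsilon> \<Longrightarrow>
      infdist x (solution_set A B) \<le> \<kappa> * residual A B x powr q"
    and L_nonneg: "L \<ge> 0" and lipschitz: "L-lipschitz_on {x. residual A B x \<le> \<epsilon>} A"
    and p_pos: "0 < p" and zeta_nonneg: "\<zeta> \<ge> 0"
    and hoelder: "\<And>x y. residual A B x \<le> \<epsilon> \<Longrightarrow> residual A B y \<le> \<epsilon> \<Longrightarrow>
      norm (DA x - DA y) \<le> \<zeta> * norm (x - y) powr p"
begin

abbreviation "r \<equiv> residual A B"
abbreviation "S \<equiv> solution_set A B"
abbreviation "d x \<equiv> infdist x S"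

lemma monotone: "monotone_operator B"
  using max_mono by (simp add: maximal_monotone_def)

lemma residual_nonneg: "r x \<ge> 0"
  by (simp add: residual_def)

lemma solution_iff: "x \<in> S \<longleftrightarrow> - A x \<in> B x"
  unfolding solution_set_def by (auto simp: add_eq_0_iff)

lemma residual_solution:
  assumes "x \<in> S"
  shows "r x = 0"
proof -
  have "resolvent B (x - A x) = x"
    using assms monotone by (intro resolvent_eqI) (auto simp: solution_iff)
  then show ?thesis
    by (simp add: residual_def residual_map_def)
qed

lemma continuous_residual: "continuous_on UNIV r"
proof -
  have "1-lipschitz_on UNIV (resolvent B)"
    using resolvent_nonexpansive[OF max_mono] by (intro lipschitz_onI) (auto simp: dist_norm)
  then have P: "continuous_on UNIV (resolvent B)"
    by (rule lipschitz_on_continuous_on)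
  have "continuous_on UNIV A"
    using deriv by (auto intro!: continuous_at_imp_continuous_on has_derivative_continuous)
  then show ?thesis
    unfolding residual_def residual_map_def
    by (intro continuous_intros continuous_on_compose2[OF P]) auto
qed

text \<open>The constant is 1 + (1 + L): the identity contributes 1, and the nonexpansive resolvent
  after \<open>Id - A\<close> contributes 1 + L.\<close>

lemma residual_lipschitz:
  assumes "r x \<le> \<epsilon>" "r y \<le> \<epsilon>"
  shows "r x \<le> r y + (L + 2) * norm (x - y)"
proof -
  have AL: "norm (A x - A y) \<le> L * norm (x - y)"
    using lipschitz_onD[OF lipschitz, of x y] assms by (simp add: dist_norm)
  have "norm (residual_map A B x - residual_map A B y) =
      norm ((x - y) - (resolvent B (x - A x) - resolvent B (y - A y)))"
    by (simp add: residual_map_def algebra_simps)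
  also have "\<dots> \<le> norm (x - y) + norm ((x - A x) - (y - A y))"
    using norm_triangle_ineq4 resolvent_nonexpansive[OF max_mono] by (smt (verit))
  also have "norm ((x - A x) - (y - A y)) \<le> norm (x - y) + norm (A x - A y)"
    using norm_triangle_ineq4[of "x - y" "A x - A y"] by (simp add: algebra_simps)
  finally have "norm (residual_map A B x - residual_map A B y) \<le> (L + 2) * norm (x - y)"
    using AL by (simp add: algebra_simps)
  then show ?thesis
    unfolding residual_def using norm_triangle_sub[of "residual_map A B x" "residual_map A B y"] by simp
qed

text \<open>No Lipschitz constant is available outside the sublevel set of the residual, but the
  residual cannot jump over the gap between the Lipschitz bound and \<open>\<epsilon>\<close>.\<close>

lemma residual_le_eps_near:
  assumes y: "r y + (L + 2) * norm (x - y) < \<epsilon>"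
  shows "r x \<le> \<epsilon>"
proof (rule ccontr)
  assume x: "\<not> r x \<le> \<epsilon>"
  define \<eta> where "\<eta> = r y + (L + 2) * norm (x - y)"
  define f where "f t = r (y + t *\<^sub>R (x - y))" for t
  have "r y \<le> \<eta>"
    using L_nonneg by (simp add: \<eta>_def)
  have "continuous_on {0..1} f"
    unfolding f_def by (intro continuous_on_compose2[OF continuous_residual] continuous_intros) auto
  \<comment> \<open>The intermediate value lies below \<epsilon>, so the Lipschitz bound applies at
    that point of the segment, and above \<eta>, so the bound is contradicted there.\<close>
  then have "\<exists>t\<ge>0. t \<le> 1 \<and> f t = (\<eta> + \<epsilon>) / 2"
    using x y \<open>r y \<le> \<eta>\<close> by (intro IVT') (auto simp: f_def \<eta>_def)
  then obtain t where t: "0 \<le> t" "t \<le> 1" "f t = (\<eta> + \<epsilon>) / 2"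
    by blast
  have "r (y + t *\<^sub>R (x - y)) \<le> r y + (L + 2) * norm (y + t *\<^sub>R (x - y) - y)"
    using t y \<open>r y \<le> \<eta>\<close> by (intro residual_lipschitz) (auto simp: f_def \<eta>_def)
  also have "\<dots> = r y + (L + 2) * (t * norm (x - y))"
    using t by simp
  also have "\<dots> \<le> r y + (L + 2) * (1 * norm (x - y))"
    using t L_nonneg by (intro add_left_mono mult_left_mono mult_right_mono) auto
  finally have "f t \<le> \<eta>"
    by (simp add: f_def \<eta>_def)
  with t y show False
    by (simp add: \<eta>_def)
qed

text \<open>The smallness condition keeps the whole segment from \<open>x\<close> to
  \<open>y\<close> in the sublevel set, where the Hoelder condition controls
  \<open>DA z - DA x\<close>; the mean value inequality then bounds the linearization error.\<close>

lemma taylor_bound: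
  assumes x: "r x + (L + 2) * norm (y - x) < \<epsilon>"
  shows "norm (A y - A x - DA x (y - x)) \<le> \<zeta> * norm (y - x) powr (1 + p)"
proof -
  define T where "T = (\<lambda>t. x + t *\<^sub>R (y - x)) ` {0..1}"
  have T: "r z \<le> \<epsilon>" "norm (z - x) \<le> norm (y - x)" if z: "z \<in> T" for z
  proof -
    show n: "norm (z - x) \<le> norm (y - x)"
      using z by (auto simp: T_def intro!: mult_left_le_one_le)
    have "(L + 2) * norm (z - x) \<le> (L + 2) * norm (y - x)"
      using n L_nonneg by (intro mult_left_mono) auto
    then show "r z \<le> \<epsilon>"
      using x by (intro residual_le_eps_near[of x]) auto
  qed
  have "norm (A y - A x - blinfun_apply (DA x) (y - x)) \<le> norm (y - x) * (\<zeta> * norm (y - x) powr p)"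
  proof (rule differentiable_bound_linearization[where S = T and f' = "\<lambda>z. blinfun_apply (DA z)"])
    show "x + t *\<^sub>R (y - x) \<in> T" if "t \<in> {0..1}" for t
      using that by (auto simp: T_def)
    show xS: "x \<in> T"
      unfolding T_def by (rule image_eqI[of _ _ 0]) auto
    show "(A has_derivative blinfun_apply (DA z)) (at z within T)" for z
      using deriv by (rule has_derivative_at_withinI)
    fix z assume z: "z \<in> T"
    have "blinfun_apply (DA z) - blinfun_apply (DA x) = blinfun_apply (DA z - DA x)"
      by (auto simp: blinfun.diff_left)
    then have "onorm (blinfun_apply (DA z) - blinfun_apply (DA x)) = norm (DA z - DA x)"
      by (simp add: norm_blinfun.rep_eq)
    also have "\<dots> \<le> \<zeta> * norm (z - x) powr p"
      using T(1)[OF z] T(1)[OF xS] by (rule hoelder)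
    also have "\<dots> \<le> \<zeta> * norm (y - x) powr p"
      using T(2)[OF z] zeta_nonneg p_pos by (intro mult_left_mono powr_mono2) auto
    finally show "onorm (blinfun_apply (DA z) - blinfun_apply (DA x)) \<le> \<zeta> * norm (y - x) powr p" .
  qed
  then show ?thesis
    by (simp add: powr_add powr_one_gt_zero_iff mult_ac)
qed

text \<open>Converse of the error bound: solutions have zero residual, so the Lipschitz estimate can
  be minimized over all of them.\<close>

lemma residual_le_infdist:
  assumes "r x \<le> \<epsilon>"
  shows "r x \<le> (L + 2) * d x"
proof -
  have "r x / (L + 2) \<le> d x"
    unfolding infdist_notempty[OF sol_nonempty]
  proof (rule cINF_greatest[OF sol_nonempty])
    fix y assume y: "y \<in> S"
    then have "r x \<le> (L + 2) * norm (x - y)"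
      using residual_lipschitz[OF assms, of y] residual_solution[OF y] eps_pos by simp
    then show "r x / (L + 2) \<le> dist x y"
      using L_nonneg by (simp add: divide_simps dist_norm mult.commute)
  qed
  then show ?thesis
    using L_nonneg by (simp add: divide_simps mult.commute)
qed

text \<open>The infimum defining the distance need not be attained; a solution within twice the
  distance replaces the projection at the cost of a constant.\<close>

lemma near_solution_exists:
  assumes "0 < d x"
  obtains y where "y \<in> S" "norm (x - y) < 2 * d x"
proof -
  have "(INF y\<in>S. dist x y) < 2 * d x"
    using assms infdist_notempty[OF sol_nonempty, of x] by simp
  moreover have "bdd_below (dist x ` S)"
    by (rule bdd_belowI[of _ 0]) auto
  ultimately obtain y where "y \<in> S" "dist x y < 2 * d x"
    using cINF_less_iff[OF sol_nonempty] by metis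
  then show ?thesis
    using that by (simp add: dist_norm)
qed

end

section \<open>One inexact Newton step\<close>

text \<open>One step that is actually taken. The bound 1 on the residual allows the exponent
  \<theta> to be lowered to \<rho>.\<close>

locale inexact_newton_step = hoelder_error_bound A DA B \<epsilon> \<kappa> q L p \<zeta>
  for A :: "'a::{real_inner, complete_space} \<Rightarrow> 'a"
    and DA :: "'a \<Rightarrow> 'a \<Rightarrow>\<^sub>L 'a"
    and B :: "'a \<Rightarrow> 'a set"
    and \<epsilon> \<kappa> q L p \<zeta> :: real +
  fixes c \<nu> \<rho> \<theta> C :: real and x x' :: 'a and J :: "'a \<Rightarrow>\<^sub>L 'a"
  assumes c_pos: "c > 0" and nu_nonneg: "\<nu> \<ge> 0" and rho_nonneg: "\<rho> \<ge> 0"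
    and theta_ge: "\<theta> \<ge> \<rho>" and C_nonneg: "C \<ge> 0"
    and residual_pos: "0 < residual A B x" and residual_le_1: "residual A B x \<le> 1"
    and psd: "positive_semidefinite J"
    and jacobian_approx: "norm (J - DA x) \<le> C * residual A B x powr \<theta>"
    and inexact: "subproblem_residual A B (damped_operator A B c \<rho> x J) x x'
        \<le> \<nu> * residual A B x powr (1 + \<rho>)"
begin

abbreviation "H \<equiv> damped_operator A B c \<rho> x J"
text \<open>The inclusion of the subproblem is solved exactly at \<open>P\<close>, not at
  \<open>x'\<close>, so monotonicity is tested at \<open>P\<close>, while
  \<open>norm (x' - P)\<close> is the subproblem residual.\<close>

abbreviation "P \<equiv> resolvent B ((x' - H x') + (H x - A x))"

lemma damped_operator_error: "norm (H v - DA x v) \<le> (c + C) * r x powr \<rho> * norm v"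
proof -
  have "norm (J - DA x) \<le> C * r x powr \<rho>"
    by (rule order_trans[OF jacobian_approx])
      (use C_nonneg theta_ge residual_pos residual_le_1 in \<open>intro mult_left_mono powr_mono'; simp\<close>)
  then have "norm ((J - DA x) v) \<le> C * r x powr \<rho> * norm v"
    using norm_blinfun[of "J - DA x" v] by (meson mult_right_mono norm_ge_zero order_trans)
  moreover have "norm (H v - DA x v) \<le> norm ((c * r x powr \<rho>) *\<^sub>R v) + norm ((J - DA x) v)"
  proof -
    have "H v - DA x v = (c * r x powr \<rho>) *\<^sub>R v + (J - DA x) v"
      by (simp add: damped_operator_def blinfun.add_left blinfun.diff_left blinfun.scaleR_left)
    then show ?thesis
      by (metis norm_triangle_ineq)
  qed
  moreover have "norm ((c * r x powr \<rho>) *\<^sub>R v) = c * r x powr \<rho> * norm v"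
    using c_pos by simp
  ultimately show ?thesis
    unfolding distrib_right by linarith
qed

lemma damped_operator_coercive: "c * r x powr \<rho> * (norm v)\<^sup>2 \<le> H v \<bullet> v"
  using psd by (simp add: damped_operator_def positive_semidefinite_def blinfun.add_left
      blinfun.scaleR_left inner_simps power2_norm_eq_inner)

lemma residual_powr_split: "r x powr (1 + \<rho>) = r x * r x powr \<rho>"
  using residual_pos by (simp add: powr_add)

lemma powr_rho_le_1: "r x powr \<rho> \<le> 1"
  using residual_pos residual_le_1 rho_nonneg by (intro powr_le1) auto

lemma inexactness_le: "norm (x' - P) \<le> \<nu> * r x * r x powr \<rho>"
  using inexact by (simp add: subproblem_residual_def residual_powr_split mult.assoc)

text \<open>Monotonicity of \<open>B\<close> between \<open>P\<close> and the solution
  \<open>xb\<close> yields \<open>H u \<bullet> u \<le> z \<bullet> u\<close>, and coercivity of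
  \<open>H\<close> turns this into a bound on \<open>u\<close> with divisor
  \<open>c * r x powr \<rho>\<close>. This division is the source of the negative power of the
  residual; the inexactness, being of order 1 + \<rho>, still contributes only a multiple of
  \<open>r x\<close>.\<close>

lemma newton_displacement:
  assumes xb: "xb \<in> S" and D: "D = norm (xb - x)"
    and near: "r x + (L + 2) * D < \<epsilon>" "r x + (L + 2) * (\<nu> * r x) < \<epsilon>" "\<nu> * r x \<le> 1"
  shows "norm (x' - x) \<le> ((1 + c + C + L + \<zeta>) * \<nu> / c + \<nu>) * r x + ((c + C) / c + 1) * D
      + \<zeta> / c * (D powr (1 + p) * r x powr - \<rho>)"
proof -
  define e where "e = x' - P"
  define u where "u = P - xb"
  define g where "g = xb - x"
  define R where "R = r x powr \<rho>"
  have R: "0 < R" "R \<le> 1"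
    using residual_pos powr_rho_le_1 by (auto simp: R_def)
  have e: "norm e \<le> \<nu> * r x * R"
    using inexactness_le by (simp add: e_def R_def)
  also have "\<dots> \<le> \<nu> * r x * 1"
    using R nu_nonneg residual_nonneg by (intro mult_left_mono) auto
  finally have e': "norm e \<le> \<nu> * r x" by simp
  have "(L + 2) * norm e \<le> (L + 2) * (\<nu> * r x)"
    using e' L_nonneg by (intro mult_left_mono) auto
  then have e_near: "r x + (L + 2) * norm ((x + e) - x) < \<epsilon>"
    using near(2) by simp
  have eps: "r x \<le> \<epsilon>"
    using e_near L_nonneg by (smt (verit) mult_nonneg_nonneg norm_ge_zero)
  \<comment> \<open>\<open>DA x e\<close> is the increment of \<open>A\<close> minus its
    linearization error. Since \<open>norm e \<le> 1\<close>, the power 1 + p in the latter is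
    absorbed.\<close>
  have DAe: "norm (DA x e) \<le> (L + \<zeta>) * norm e"
  proof -
    have "norm (A (x + e) - A x) \<le> L * norm e"
      using lipschitz_onD[OF lipschitz, of "x + e" x] residual_le_eps_near[OF e_near] eps
      by (simp add: dist_norm)
    moreover have "norm (A (x + e) - A x - DA x e) \<le> \<zeta> * norm e powr (1 + p)"
      using taylor_bound[OF e_near] by simp
    moreover have "norm e powr (1 + p) \<le> norm e"
    proof -
      have "norm e powr p \<le> 1"
        using e' near(3) p_pos by (intro powr_le1) auto
      then have "norm e * norm e powr p \<le> norm e * 1"
        by (intro mult_left_mono) auto
      then show ?thesis
        by (simp add: powr_add)
    qed
    then have "\<zeta> * norm e powr (1 + p) \<le> \<zeta> * norm e"
      using zeta_nonneg by (intro mult_left_mono)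
    ultimately have "norm (A (x + e) - A x) + norm (A (x + e) - A x - DA x e) \<le> (L + \<zeta>) * norm e"
      by (simp add: algebra_simps)
    then show ?thesis
      using norm_triangle_ineq4[of "A (x + e) - A x" "A (x + e) - A x - DA x e"] by simp
  qed
  \<comment> \<open>Everything in the difference of the two elements of \<open>B\<close> other than
    \<open>- H u\<close>, using \<open>x' - x = u + e + g\<close>. The derivative terms are inserted
    so that each group is small by an earlier estimate.\<close>
  define z where "z = e - DA x e - (H e - DA x e) + (A xb - A x - DA x g) - (H g - DA x g)"
  have "norm z \<le> norm e + norm (DA x e) + norm (H e - DA x e) + norm (A xb - A x - DA x g)
      + norm (H g - DA x g)"
    unfolding z_def
    by (intro order_trans[OF norm_triangle_ineq4] order_trans[OF norm_triangle_ineq] add_mono order_refl)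
  also have "\<dots> \<le> norm e + (L + \<zeta>) * norm e + (c + C) * R * norm e + \<zeta> * D powr (1 + p)
      + (c + C) * R * D"
    using taylor_bound[of x xb] near(1) DAe damped_operator_error[of e] damped_operator_error[of g]
    by (intro add_mono) (auto simp: g_def R_def D)
  also have "(c + C) * R * norm e \<le> (c + C) * 1 * norm e"
    using R c_pos C_nonneg by (intro mult_right_mono mult_left_mono) auto
  finally have "norm z \<le> (1 + c + C + L + \<zeta>) * norm e + \<zeta> * D powr (1 + p) + (c + C) * R * D"
    by (simp add: algebra_simps)
  \<comment> \<open>The bound on \<open>e\<close> that retains the factor \<open>R\<close> is used,
    so that this factor cancels in the division by \<open>c * R\<close>.\<close>
  also have "(1 + c + C + L + \<zeta>) * norm e \<le> (1 + c + C + L + \<zeta>) * (\<nu> * r x * R)"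
    using e c_pos C_nonneg L_nonneg zeta_nonneg by (intro mult_left_mono) auto
  finally have z: "norm z \<le> (1 + c + C + L + \<zeta>) * (\<nu> * r x * R) + \<zeta> * D powr (1 + p) + (c + C) * R * D"
    by simp

  have "((x' - H x') + (H x - A x) - P) \<in> B P"
    by (rule resolvent_mem[OF max_mono])
  moreover have "- A xb \<in> B xb"
    using xb by (simp add: solution_iff)
  ultimately have "(((x' - H x') + (H x - A x) - P) - (- A xb)) \<bullet> (P - xb) \<ge> 0"
    using monotone unfolding monotone_operator_def by blast
  moreover have "((x' - H x') + (H x - A x) - P) - (- A xb) = z - H u"
  proof -
    have "((x' - H x') + (H x - A x) - P) - (- A xb) = e - H x' + H x - A x + A xb"
      by (simp add: e_def)
    moreover have "x' = u + e + g + x"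
      by (simp add: u_def e_def g_def)
    then have "H x' = H u + H e + H g + H x"
      by (metis blinfun.add_right)
    ultimately show ?thesis
      by (simp add: z_def)
  qed
  ultimately have "H u \<bullet> u \<le> z \<bullet> u"
    by (simp add: u_def[symmetric] inner_diff_left)
  with damped_operator_coercive[of u] have "c * R * (norm u)\<^sup>2 \<le> z \<bullet> u"
    by (simp add: R_def)
  also have "\<dots> \<le> norm z * norm u"
    by (rule norm_cauchy_schwarz)
  finally have "c * R * norm u * norm u \<le> norm z * norm u"
    by (simp add: power2_eq_square mult.assoc)
  then have "c * R * norm u \<le> norm z"
    by (cases "norm u = 0") auto
  then have "norm u \<le> norm z / (c * R)"
    using R c_pos by (simp add: pos_le_divide_eq mult.commute)
  also have "\<dots> \<le> ((1 + c + C + L + \<zeta>) * (\<nu> * r x * R) + \<zeta> * D powr (1 + p) + (c + C) * R * D) / (c * R)"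
    using z R c_pos by (intro divide_right_mono) auto
  also have "\<dots> = (1 + c + C + L + \<zeta>) * \<nu> / c * r x + \<zeta> / c * (D powr (1 + p) * r x powr - \<rho>)
      + (c + C) / c * D"
  proof -
    have "(X * (\<nu> * r x * R) + Y + Z * R * D) / (c * R) = X * \<nu> / c * r x + Y / (c * R) + Z / c * D" for X Y Z
      using R c_pos by (simp add: field_simps)
    moreover have "\<zeta> * D powr (1 + p) / (c * R) = \<zeta> / c * (D powr (1 + p) * r x powr - \<rho>)"
      by (simp add: powr_minus R_def divide_inverse mult_ac)
    ultimately show ?thesis
      by simp
  qed
  finally have u: "norm u \<le> (1 + c + C + L + \<zeta>) * \<nu> / c * r x + \<zeta> / c * (D powr (1 + p) * r x powr - \<rho>)
      + (c + C) / c * D" .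
  have "x' - x = u + e + g"
    by (simp add: u_def e_def g_def)
  then have "norm (x' - x) \<le> norm u + norm e + norm g"
    by (metis norm_triangle_mono norm_triangle_ineq order_refl)
  also have "norm g = D"
    by (simp add: g_def D)
  finally show ?thesis
    using u e' by (simp add: algebra_simps)
qed

text \<open>\<open>P\<close> and the point \<open>resolvent B (x' - A x')\<close> defining the
  residual are values of the same resolvent, and their arguments differ only by the linearization
  error and by \<open>H - DA x\<close> applied to the step.\<close>

lemma newton_residual:
  assumes near: "r x + (L + 2) * norm (x' - x) < \<epsilon>"
  shows "r x' \<le> \<nu> * r x powr (1 + \<rho>) + \<zeta> * norm (x' - x) powr (1 + p)
      + (c + C) * r x powr \<rho> * norm (x' - x)"
proof -
  define h where "h = x' - x"
  have Hh: "H h = H x' - H x"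
    by (simp add: h_def blinfun.diff_right)
  have "norm (P - resolvent B (x' - A x')) \<le> norm (((x' - H x') + (H x - A x)) - (x' - A x'))"
    by (rule resolvent_nonexpansive[OF max_mono])
  also have "((x' - H x') + (H x - A x)) - (x' - A x') = (A x' - A x - DA x h) - (H h - DA x h)"
    by (simp add: Hh)
  also have "norm \<dots> \<le> norm (A x' - A x - DA x h) + norm (H h - DA x h)"
    by (rule norm_triangle_ineq4)
  also have "\<dots> \<le> \<zeta> * norm h powr (1 + p) + (c + C) * r x powr \<rho> * norm h"
    using taylor_bound[OF near] by (intro add_mono damped_operator_error) (simp add: h_def)
  finally have "norm (P - resolvent B (x' - A x')) \<le> \<dots>" .
  moreover have "norm (x' - P) \<le> \<nu> * r x powr (1 + \<rho>)"
    using inexact by (simp add: subproblem_residual_def)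
  moreover have "r x' \<le> norm (x' - P) + norm (P - resolvent B (x' - A x'))"
    unfolding residual_def residual_map_def
    using norm_triangle_ineq[of "x' - P" "P - resolvent B (x' - A x')"] by simp
  ultimately show ?thesis
    by (simp add: h_def)
qed

end

section \<open>The new residual in terms of the old distance\<close>

context hoelder_error_bound
begin

text \<open>The step length is O(d + d^a) with a = 1 + p - \<rho>/q, because the error bound turns
  the factor r^(-\<rho>) into d^(-\<rho>/q). Inserted into \<open>newton_residual\<close>, this
  leaves the powers 1 + \<rho>, 1 + p and a(1 + p) of d, which are the three upper bounds imposed on
  \<sigma>.\<close>

lemma newton_step_near_solution:
  fixes c \<nu> \<rho> \<theta> C \<sigma> :: real
  assumes pars: "c > 0" "\<nu> \<ge> 0" "\<rho> \<ge> 0" "\<theta> \<ge> \<rho>" "C \<ge> 0"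
    and a_pos: "1 + p - \<rho> / q > 0"
    and sigma: "\<sigma> \<le> 1 + \<rho>" "\<sigma> \<le> 1 + p" "\<sigma> \<le> (1 + p - \<rho> / q) * (1 + p)"
  shows "\<exists>\<delta>>0. \<exists>K\<ge>0. \<forall>x x' J. inexact_newton_step A DA B \<epsilon> \<kappa> q L p \<zeta> c \<nu> \<rho> \<theta> C x x' J \<and> r x \<le> \<delta> \<longrightarrow>
    r x' \<le> \<epsilon> \<and> r x' \<le> K * d x powr \<sigma>"
proof -
  define M where "M = L + 2"
  define a where "a = 1 + p - \<rho> / q"
  define k where "k = \<kappa> powr (\<rho> / q)"
  define K1 where "K1 = ((1 + c + C + L + \<zeta>) * \<nu> / c + \<nu>) + ((c + C) / c + 1) + \<zeta> / c"
  define K2 where "K2 = K1 * (M + 2 + 2 powr (1 + p))"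
  define K where "K = \<nu> * M powr (1 + \<rho>) + \<zeta> * (K2 * (1 + k)) powr (1 + p) + (c + C) * (K2 * (M powr \<rho> + 1))"
  define b where "b t = \<kappa> * t powr q" for t
  have M: "M > 0" and k: "k > 0"
    using L_nonneg kappa_pos by (auto simp: M_def k_def)
  have K1_parts: "0 \<le> (1 + c + C + L + \<zeta>) * \<nu> / c + \<nu>" "0 \<le> (c + C) / c + 1" "0 \<le> \<zeta> / c"
    using pars L_nonneg zeta_nonneg by auto
  then have K1: "K1 \<ge> 0"
    by (simp add: K1_def)
  then have K2: "K2 \<ge> 0"
    using M by (simp add: K2_def)
  have K: "K \<ge> 0"
    using pars M K2 zeta_nonneg by (simp add: K_def)

  have id0: "((\<lambda>t::real. t) \<longlongrightarrow> 0) (at_right 0)"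
    by (rule tendsto_ident_at)
  have pos: "\<forall>\<^sub>F t::real in at_right 0. 0 < t"
    by (auto simp: eventually_at_right_field intro: exI[of _ 1])
  then have nn: "\<forall>\<^sub>F t::real in at_right 0. 0 \<le> t"
    by eventually_elim simp
  have b0: "(b \<longlongrightarrow> 0) (at_right 0)"
    unfolding b_def
    using tendsto_mult_right_zero[OF tendsto_zero_powrI[OF id0 tendsto_const nn q_pos], of \<kappa>] by simp
  have b_nn: "\<forall>\<^sub>F t in at_right 0. 0 \<le> b t"
    using kappa_pos by (auto simp: b_def)
  have ba0: "((\<lambda>t. b t powr a) \<longlongrightarrow> 0) (at_right 0)"
    using a_pos by (intro tendsto_zero_powrI[OF b0 tendsto_const b_nn]) (simp add: a_def)
  \<comment> \<open>Five conditions on small residuals \<open>t\<close>, with \<open>b t\<close> as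
    the majorant of the distance. They serve, in order, the near solution, the inexactness in
    \<open>newton_displacement\<close> (two conditions), the step in \<open>newton_residual\<close>,
    and the comparison of powers of a distance at most 1.\<close>
  have "((\<lambda>t. t + M * (2 * b t)) \<longlongrightarrow> 0 + M * (2 * 0)) (at_right 0)"
    by (intro tendsto_intros id0 b0)
  then have "\<forall>\<^sub>F t in at_right 0. t + M * (2 * b t) < \<epsilon>"
    by (rule order_tendstoD) (simp add: eps_pos)
  moreover have "((\<lambda>t. t + M * (\<nu> * t)) \<longlongrightarrow> 0 + M * (\<nu> * 0)) (at_right 0)"
    by (intro tendsto_intros id0)
  then have "\<forall>\<^sub>F t in at_right 0. t + M * (\<nu> * t) < \<epsilon>"
    by (rule order_tendstoD) (simp add: eps_pos)
  moreover have "((\<lambda>t. \<nu> * t) \<longlongrightarrow> \<nu> * 0) (at_right 0)"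
    by (intro tendsto_intros id0)
  then have "\<forall>\<^sub>F t in at_right 0. \<nu> * t < 1"
    by (rule order_tendstoD) simp
  moreover have "((\<lambda>t. t + M * (K2 * (b t + k * b t powr a))) \<longlongrightarrow> 0 + M * (K2 * (0 + k * 0))) (at_right 0)"
    by (intro tendsto_add tendsto_mult tendsto_const id0 b0 ba0)
  then have "\<forall>\<^sub>F t in at_right 0. t + M * (K2 * (b t + k * b t powr a)) < \<epsilon>"
    by (rule order_tendstoD) (simp add: eps_pos)
  moreover have "\<forall>\<^sub>F t in at_right 0. b t < 1"
    using b0 by (rule order_tendstoD) simp
  ultimately have "\<forall>\<^sub>F t in at_right 0. t + M * (2 * b t) < \<epsilon> \<and> t + M * (\<nu> * t) < \<epsilon> \<and> \<nu> * t < 1 \<and>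
      t + M * (K2 * (b t + k * b t powr a)) < \<epsilon> \<and> b t < 1"
    by eventually_elim simp
  then obtain \<delta> where \<delta>: "\<delta> > 0" "\<And>t. 0 < t \<Longrightarrow> t < \<delta> \<Longrightarrow>
      t + M * (2 * b t) < \<epsilon> \<and> t + M * (\<nu> * t) < \<epsilon> \<and> \<nu> * t < 1 \<and>
      t + M * (K2 * (b t + k * b t powr a)) < \<epsilon> \<and> b t < 1"
    unfolding eventually_at_right_field by auto

  have "r x' \<le> \<epsilon> \<and> r x' \<le> K * d x powr \<sigma>"
    if step: "inexact_newton_step A DA B \<epsilon> \<kappa> q L p \<zeta> c \<nu> \<rho> \<theta> C x x' J" and rx_le: "r x \<le> \<delta> / 2" for x x' J
  proof -
    interpret inexact_newton_step A DA B \<epsilon> \<kappa> q L p \<zeta> c \<nu> \<rho> \<theta> C x x' J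
      by (rule step)
    have small: "r x + M * (2 * b (r x)) < \<epsilon>" "r x + M * (\<nu> * r x) < \<epsilon>" "\<nu> * r x < 1"
      "r x + M * (K2 * (b (r x) + k * b (r x) powr a)) < \<epsilon>" "b (r x) < 1"
      using \<delta> rx_le residual_pos by auto
    have eps: "r x \<le> \<epsilon>"
      using small(1) M kappa_pos by (smt (verit) b_def mult_nonneg_nonneg powr_ge_zero)
    have d_le: "d x \<le> b (r x)"
      using error_bound[OF eps] by (simp add: b_def)
    have r_le: "r x \<le> M * d x"
      using residual_le_infdist[OF eps] by (simp add: M_def)
    have d_pos: "d x > 0"
      using r_le residual_pos M by (smt (verit) mult_nonneg_nonpos)
    have d_1: "d x \<le> 1"
      using d_le small by simp
    have dpow: "d x powr \<tau> \<le> d x powr \<sigma>" if "\<sigma> \<le> \<tau>" for \<tau>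
      using that d_pos d_1 by (intro powr_mono') auto
    obtain xb where xb: "xb \<in> S" "norm (x - xb) < 2 * d x"
      using near_solution_exists[OF d_pos] .
    define D where "D = norm (xb - x)"
    have D: "0 \<le> D" "D \<le> 2 * d x"
      using xb by (auto simp: D_def norm_minus_commute)
    define E where "E = d x powr (1 + p) * r x powr - \<rho>"
    have E: "E \<ge> 0" "E \<le> k * d x powr a"
    proof -
      \<comment> \<open>Because the exponent is nonpositive, the error bound enters as a lower bound
        on the residual.\<close>
      have "r x powr - \<rho> = (r x powr q) powr (- \<rho> / q)"
        using q_pos by (simp add: powr_powr)
      also have "\<dots> \<le> (d x / \<kappa>) powr (- \<rho> / q)"
        using d_le d_pos kappa_pos q_pos pars
        by (intro powr_mono2') (auto simp: b_def divide_simps mult.commute)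
      also have "\<dots> = k * d x powr (- \<rho> / q)"
        using d_pos kappa_pos by (simp add: powr_divide k_def powr_minus divide_simps)
      finally have "E \<le> d x powr (1 + p) * (k * d x powr (- \<rho> / q))"
        unfolding E_def by (intro mult_left_mono) auto
      also have "\<dots> = k * d x powr a"
        by (simp add: a_def powr_add[symmetric])
      finally show "E \<le> k * d x powr a" .
    qed (simp add: E_def)

    define h where "h = norm (x' - x)"
    have "M * D \<le> M * (2 * b (r x))"
      using D d_le M by (intro mult_left_mono) auto
    then have "h \<le> ((1 + c + C + L + \<zeta>) * \<nu> / c + \<nu>) * r x + ((c + C) / c + 1) * D
        + \<zeta> / c * (D powr (1 + p) * r x powr - \<rho>)"
      unfolding h_def using small by (intro newton_displacement[OF xb(1) D_def]) (auto simp: M_def)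
    also have "\<dots> \<le> K1 * r x + K1 * D + K1 * (D powr (1 + p) * r x powr - \<rho>)"
      using K1_parts D residual_nonneg[of x]
      by (intro add_mono mult_right_mono) (auto simp: K1_def)
    also have "\<dots> \<le> K1 * (M * d x) + K1 * (2 * d x) + K1 * (2 powr (1 + p) * E)"
    proof -
      have "D powr (1 + p) \<le> (2 * d x) powr (1 + p)"
        using D p_pos by (intro powr_mono2) auto
      then have "D powr (1 + p) * r x powr - \<rho> \<le> 2 powr (1 + p) * E"
        using d_pos by (simp add: E_def powr_mult mult_right_mono flip: mult.assoc)
      then show ?thesis
        using K1 r_le D by (intro add_mono mult_left_mono) auto
    qed
    also have "\<dots> \<le> K2 * (d x + E)"
    proof -
      have "K2 * (d x + E) - (K1 * (M * d x) + K1 * (2 * d x) + K1 * (2 powr (1 + p) * E))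
          = K1 * (2 powr (1 + p) * d x + (M + 2) * E)"
        by (simp add: K2_def algebra_simps)
      moreover have "\<dots> \<ge> 0"
        using K1 M E d_pos by simp
      ultimately show ?thesis by linarith
    qed
    finally have h: "h \<le> K2 * (d x + E)" .
    then have h_a: "h \<le> K2 * (d x + k * d x powr a)"
      using E K2 by (smt (verit) mult_left_mono)
    have h_nn: "h \<ge> 0"
      by (simp add: h_def)

    have "M * h \<le> M * (K2 * (b (r x) + k * b (r x) powr a))"
    proof (intro mult_left_mono order_trans[OF h_a] add_mono d_le)
      show "d x powr a \<le> b (r x) powr a"
        using d_le d_pos a_pos by (intro powr_mono2) (auto simp: a_def)
    qed (use K2 M k in auto)
    then have near: "r x + (L + 2) * norm (x' - x) < \<epsilon>"
      using small by (simp add: M_def h_def)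
    have "r x' \<le> \<nu> * r x powr (1 + \<rho>) + \<zeta> * h powr (1 + p) + (c + C) * (r x powr \<rho> * h)"
      using newton_residual[OF near] by (simp add: h_def mult.assoc)
    also have "\<dots> \<le> \<nu> * (M powr (1 + \<rho>) * d x powr \<sigma>) + \<zeta> * ((K2 * (1 + k)) powr (1 + p) * d x powr \<sigma>)
        + (c + C) * (K2 * (M powr \<rho> + 1) * d x powr \<sigma>)"
    proof (intro add_mono mult_left_mono)
      have r_powr: "r x powr \<tau> \<le> M powr \<tau> * d x powr \<tau>" if "\<tau> \<ge> 0" for \<tau>
        using powr_mono2[OF that residual_nonneg r_le] M d_pos by (simp add: powr_mult)
      show "r x powr (1 + \<rho>) \<le> M powr (1 + \<rho>) * d x powr \<sigma>"
        by (rule order_trans[OF r_powr]) (use pars sigma in \<open>auto intro!: mult_left_mono dpow\<close>)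
      show "h powr (1 + p) \<le> (K2 * (1 + k)) powr (1 + p) * d x powr \<sigma>"
      proof -
        \<comment> \<open>As \<open>d x \<le> 1\<close>, both \<open>d x\<close> and
          \<open>d x powr a\<close> are at most \<open>d x powr g\<close>, and
          \<open>g * (1 + p) \<ge> \<sigma>\<close> in either case of the minimum.\<close>
        define g where "g = min 1 a"
        have "d x powr 1 \<le> d x powr g" "d x powr a \<le> d x powr g"
          by (rule powr_mono'; use d_pos d_1 in \<open>simp add: g_def\<close>)+
        then have "d x + k * d x powr a \<le> d x powr g + k * d x powr g"
          using k d_pos by (intro add_mono mult_left_mono) auto
        then have "h \<le> K2 * (d x powr g + k * d x powr g)"
          using h_a K2 by (meson mult_left_mono order_trans)
        then have "h \<le> K2 * (1 + k) * d x powr g"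
          by (simp add: algebra_simps)
        then have "h powr (1 + p) \<le> (K2 * (1 + k) * d x powr g) powr (1 + p)"
          using h_nn p_pos by (intro powr_mono2) auto
        also have "\<dots> = (K2 * (1 + k)) powr (1 + p) * d x powr (g * (1 + p))"
          using K2 k by (simp add: powr_mult powr_powr)
        also have "\<dots> \<le> (K2 * (1 + k)) powr (1 + p) * d x powr \<sigma>"
          using sigma by (intro mult_left_mono dpow) (auto simp: g_def a_def min_def)
        finally show ?thesis .
      qed
      \<comment> \<open>The bound on \<open>h\<close> through \<open>E\<close> is used rather than
        \<open>h_a\<close>: the factor \<open>r x powr \<rho>\<close> cancels the negative power
        inside \<open>E\<close> exactly, leaving \<open>d x powr (1 + p)\<close>.\<close>
      have "r x powr \<rho> * h \<le> r x powr \<rho> * (K2 * (d x + E))"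
        using h by (intro mult_left_mono) auto
      also have "\<dots> = K2 * (r x powr \<rho> * d x + d x powr (1 + p))"
        using residual_pos by (simp add: E_def algebra_simps powr_minus)
      also have "\<dots> \<le> K2 * (M powr \<rho> * d x powr \<sigma> + d x powr \<sigma>)"
      proof (intro mult_left_mono[OF _ K2] add_mono dpow sigma)
        have "r x powr \<rho> * d x \<le> M powr \<rho> * d x powr \<rho> * d x"
          using r_powr[of \<rho>] pars d_pos by (intro mult_right_mono) auto
        also have "\<dots> = M powr \<rho> * d x powr (1 + \<rho>)"
          using d_pos by (simp add: powr_add)
        also have "\<dots> \<le> M powr \<rho> * d x powr \<sigma>"
          by (intro mult_left_mono dpow sigma) auto
        finally show "r x powr \<rho> * d x \<le> M powr \<rho> * d x powr \<sigma>" .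
      qed
      finally show "r x powr \<rho> * h \<le> K2 * (M powr \<rho> + 1) * d x powr \<sigma>"
        by (simp add: algebra_simps)
    qed (use pars zeta_nonneg in auto)
    also have "\<dots> = K * d x powr \<sigma>"
      by (simp add: K_def algebra_simps)
    finally have "r x' \<le> K * d x powr \<sigma>" .
    moreover have "r x' \<le> \<epsilon>"
      using near by (rule residual_le_eps_near)
    ultimately show ?thesis by blast
  qed
  then show ?thesis
    using \<delta>(1) K by (intro exI[of _ "\<delta> / 2"]) auto
qed

end

section \<open>Rates of convergence\<close>

text \<open>Split off one factor \<open>f t\<close>; what remains, \<open>K * f t powr s\<close>,
  tends to 0. If \<open>f t = 0\<close>, the bound itself forces the next term to vanish.\<close>

lemma Q_superlinear_to_zeroI:
  fixes f :: "nat \<Rightarrow> real"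
  assumes lim: "f \<longlonglongrightarrow> 0" and nonneg: "\<And>t. f t \<ge> 0" and s: "s > 0"
    and bound: "\<And>t. f (Suc t) \<le> K * f t powr (1 + s)"
  shows "Q_superlinear_to_zero f"
proof -
  have "((\<lambda>t. K * f t powr s) \<longlongrightarrow> K * 0) sequentially"
    using lim s nonneg by (intro tendsto_mult tendsto_const tendsto_zero_powrI[OF lim tendsto_const]) auto
  then have lim0: "((\<lambda>t. K * f t powr s) \<longlongrightarrow> 0) sequentially"
    by simp
  have "(\<lambda>t. f (Suc t)) \<in> o(f)"
  proof (rule landau_o.smallI)
    fix e :: real assume "e > 0"
    with lim0 have "\<forall>\<^sub>F t in sequentially. K * f t powr s < e"
      by (rule order_tendstoD)
    then show "\<forall>\<^sub>F t in sequentially. norm (f (Suc t)) \<le> e * norm (f t)"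
    proof eventually_elim
      case (elim t)
      have "f (Suc t) \<le> (K * f t powr s) * f t"
        using bound[of t] nonneg[of t] by (cases "f t = 0") (auto simp: powr_add mult_ac)
      also have "\<dots> \<le> e * f t"
        using elim nonneg[of t] by (intro mult_right_mono) auto
      finally show ?case
        using nonneg by simp
    qed
  qed
  with lim show ?thesis
    by (simp add: Q_superlinear_to_zero_def)
qed

lemma bigo_powr_of_nonneg_le:
  fixes f :: "nat \<Rightarrow> real"
  assumes "\<And>t. f t \<ge> 0" and "\<And>t. f (Suc t) \<le> K * f t powr s"
  shows "(\<lambda>t. f (Suc t)) \<in> O(\<lambda>t. f t powr s)"
  by (rule bigoI[of _ K]) (simp add: assms)

text \<open>Supplies the threshold below which each step at least halves the residual, so that later
  iterates never leave the region where the estimates hold.\<close>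

lemma eventually_contracting:
  assumes "s > 0"
  shows "\<exists>\<eta>>0. \<forall>t. 0 \<le> t \<and> t \<le> \<eta> \<longrightarrow> K * t powr (1 + s) \<le> t / (2::real)"
proof -
  have "((\<lambda>t::real. K * t powr s) \<longlongrightarrow> K * 0) (at_right 0)"
  proof (intro tendsto_mult tendsto_const tendsto_zero_powrI[OF tendsto_ident_at tendsto_const _ assms])
    show "\<forall>\<^sub>F t::real in at_right 0. 0 \<le> t"
      by (auto simp: eventually_at_right_field intro: exI[of _ 1])
  qed
  then have "\<forall>\<^sub>F t in at_right 0. K * t powr s < 1 / 2"
    by (intro order_tendstoD) auto
  then obtain b where b: "b > 0" "\<And>t. 0 < t \<Longrightarrow> t < b \<Longrightarrow> K * t powr s < 1 / 2"
    unfolding eventually_at_right_field by auto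
  have "K * t powr (1 + s) \<le> t / 2" if "0 \<le> t" "t \<le> b / 2" for t
  proof (cases "t = 0")
    case False
    then have "K * t powr s * t \<le> 1 / 2 * t"
      using that b(1) b(2)[of t] by (intro mult_right_mono) auto
    then show ?thesis
      using False that by (simp add: powr_add mult_ac)
  qed simp
  then show ?thesis
    using b(1) by (intro exI[of _ "b / 2"]) auto
qed

theorem theorem2p3:
  fixes A :: "'a::{real_inner, complete_space} \<Rightarrow> 'a"
    and DA :: "'a \<Rightarrow> 'a \<Rightarrow>\<^sub>L 'a"
    and B :: "'a \<Rightarrow> 'a set"
    and c \<nu> \<rho> \<theta> C \<epsilon> \<kappa> q L p \<zeta> s :: real
    and V :: "'a set"
  assumes "\<And>x. (A has_derivative blinfun_apply (DA x)) (at x)"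
    and "continuous_on UNIV DA"
    and "maximal_monotone B"
    and "solution_set A B \<noteq> {}"
    and "c > 0" and "\<nu> \<ge> 0" and "\<rho> \<ge> 0" and "\<theta> \<ge> \<rho>" and "C > 0"
    and "\<epsilon> > 0" and "\<kappa> > 0" and "q > 0"
    and "V = {x. residual A B x \<le> \<epsilon>}"
    and "\<And>x. x \<in> V \<Longrightarrow> infdist x (solution_set A B) \<le> \<kappa> * residual A B x powr q"
    and "L \<ge> 0" and "L-lipschitz_on V A"
    and "0 < p" and "p \<le> 1" and "\<zeta> \<ge> 0"
    and "\<And>x y. x \<in> V \<Longrightarrow> y \<in> V \<Longrightarrow> norm (DA x - DA y) \<le> \<zeta> * norm (x - y) powr p"
    and "(1 + \<rho>) * q > 1" and "(1 + p) * q > 1" and "(q + p * q - \<rho>) * (1 + p) > 1"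
    and "s = Min {(1 + \<rho>) * q, (1 + p) * q, (q + p * q - \<rho>) * (1 + p)} - 1"
  shows "s > 0 \<and>
    (\<exists>\<delta>>0. \<forall>x J.
       inexact_newton_sequence A DA B c \<nu> \<rho> \<theta> C J x \<and> residual A B (x 0) \<le> \<delta> \<longrightarrow>
         Q_superlinear_to_zero (\<lambda>t. residual A B (x t)) \<and>
         Q_superlinear_to_zero (\<lambda>t. infdist (x t) (solution_set A B)) \<and>
         (\<lambda>t. residual A B (x (Suc t))) \<in> O(\<lambda>t. residual A B (x t) powr (1 + s)) \<and>
         (\<lambda>t. infdist (x (Suc t)) (solution_set A B))
           \<in> O(\<lambda>t. infdist (x t) (solution_set A B) powr (1 + s)))"
proof
  have s_le: "1 + s \<le> (1 + \<rho>) * q" "1 + s \<le> (1 + p) * q" "1 + s \<le> (q + p * q - \<rho>) * (1 + p)"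
    using assms(24) by auto
  show s: "s > 0"
    using assms(21-24) by auto
  interpret hoelder_error_bound A DA B \<epsilon> \<kappa> q L p \<zeta>
    using assms(1,3,4,10-12,15,17,19) assms(14,16,20)[unfolded assms(13) mem_Collect_eq]
    by unfold_locales
  define \<sigma> where "\<sigma> = (1 + s) / q"
  have q\<sigma>: "q * \<sigma> = 1 + s"
    using q_pos by (simp add: \<sigma>_def)
  have "0 < (q + p * q - \<rho>) * (1 + p)"
    using assms(23) by linarith
  then have "0 < q + p * q - \<rho>"
    using p_pos by (simp add: zero_less_mult_iff)
  then have a_pos: "1 + p - \<rho> / q > 0"
    using q_pos by (simp add: field_simps)
  have "(1 + p - \<rho> / q) * (1 + p) = (q + p * q - \<rho>) * (1 + p) / q"
    using q_pos by (simp add: field_simps)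
  then have sigma: "\<sigma> \<le> 1 + \<rho>" "\<sigma> \<le> 1 + p" "\<sigma> \<le> (1 + p - \<rho> / q) * (1 + p)"
    using s_le q_pos by (simp_all add: \<sigma>_def divide_right_mono pos_divide_le_eq)
  obtain \<delta>0 K where \<delta>0: "\<delta>0 > 0" and K: "K \<ge> 0" and near: "\<And>x x' J.
      inexact_newton_step A DA B \<epsilon> \<kappa> q L p \<zeta> c \<nu> \<rho> \<theta> C x x' J \<Longrightarrow> r x \<le> \<delta>0 \<Longrightarrow>
      r x' \<le> \<epsilon> \<and> r x' \<le> K * d x powr \<sigma>"
    using newton_step_near_solution[OF assms(5-8) less_imp_le[OF assms(9)] a_pos sigma] by blast
  \<comment> \<open>\<open>Kr\<close> arises from the error bound at the old iterate,
    \<open>Kd\<close> from the error bound at the new one.\<close>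
  define Kr where "Kr = K * \<kappa> powr \<sigma>"
  define Kd where "Kd = \<kappa> * K powr q"
  obtain \<eta> where \<eta>: "\<eta> > 0" "\<And>t. 0 \<le> t \<Longrightarrow> t \<le> \<eta> \<Longrightarrow> Kr * t powr (1 + s) \<le> t / 2"
    using eventually_contracting[OF s] by blast
  \<comment> \<open>The entries secure, in order, lowering \<theta> to \<rho>, the error bound, the
    one-step estimate, and halving of the residual.\<close>
  define \<delta> where "\<delta> = Min {1, \<epsilon>, \<delta>0, \<eta>}"
  have \<delta>: "\<delta> > 0" "\<delta> \<le> 1" "\<delta> \<le> \<epsilon>" "\<delta> \<le> \<delta>0" "\<delta> \<le> \<eta>"
    using \<delta>0 \<eta>(1) eps_pos by (auto simp: \<delta>_def)
  have step: "r (x (Suc t)) \<le> Kr * r (x t) powr (1 + s)"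
      "d (x (Suc t)) \<le> Kd * d (x t) powr (1 + s)"
    if seq: "inexact_newton_sequence A DA B c \<nu> \<rho> \<theta> C J x" and le: "r (x t) \<le> \<delta>" for x J t
  proof -
    have d_le: "d (x t) \<le> \<kappa> * r (x t) powr q"
      using le \<delta> by (intro error_bound) auto
    have "r (x (Suc t)) \<le> Kr * r (x t) powr (1 + s) \<and> d (x (Suc t)) \<le> Kd * d (x t) powr (1 + s)"
    proof (cases "r (x t) = 0")
      \<comment> \<open>After stopping the iterate stays put and, as \<open>0 powr q = 0\<close>,
        the error bound gives distance 0; both rates then hold with zero on each side.\<close>
      case True
      then have "x (Suc t) = x t"
        using seq by (auto simp: inexact_newton_sequence_def)
      moreover have "d (x t) = 0"
        using d_le True by (simp add: order_antisym infdist_nonneg)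
      ultimately show ?thesis
        using True by simp
    next
      case False
      then have "inexact_newton_step A DA B \<epsilon> \<kappa> q L p \<zeta> c \<nu> \<rho> \<theta> C (x t) (x (Suc t)) (J t)"
        using seq le \<delta> assms(5-9) residual_nonneg[of "x t"] unfolding inexact_newton_sequence_def
        by unfold_locales (auto simp: less_le)
      from near[OF this] le \<delta> have *: "r (x (Suc t)) \<le> \<epsilon>" "r (x (Suc t)) \<le> K * d (x t) powr \<sigma>"
        by auto
      have \<sigma>_pos: "\<sigma> > 0"
        using s q_pos by (simp add: \<sigma>_def)
      have "d (x t) powr \<sigma> \<le> (\<kappa> * r (x t) powr q) powr \<sigma>"
        using d_le \<sigma>_pos by (intro powr_mono2) (auto simp: infdist_nonneg)
      also have "\<dots> = \<kappa> powr \<sigma> * r (x t) powr (1 + s)"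
        using kappa_pos by (simp add: powr_mult powr_powr q\<sigma>)
      finally have 1: "r (x (Suc t)) \<le> Kr * r (x t) powr (1 + s)"
        using *(2) K unfolding Kr_def by (smt (verit) mult.assoc mult_left_mono)
      have "d (x (Suc t)) \<le> \<kappa> * r (x (Suc t)) powr q"
        by (rule error_bound[OF *(1)])
      also have "\<dots> \<le> \<kappa> * (K * d (x t) powr \<sigma>) powr q"
        using *(2) kappa_pos q_pos by (intro mult_left_mono powr_mono2) (auto simp: residual_nonneg)
      also have "\<dots> = Kd * d (x t) powr (1 + s)"
        using K q\<sigma> by (simp add: Kd_def powr_mult powr_powr mult.commute[of \<sigma>])
      finally show ?thesis
        using 1 by simp
    qed
    then show "r (x (Suc t)) \<le> Kr * r (x t) powr (1 + s)"
      "d (x (Suc t)) \<le> Kd * d (x t) powr (1 + s)" by auto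
  qed
  have "Q_superlinear_to_zero (\<lambda>t. r (x t)) \<and> Q_superlinear_to_zero (\<lambda>t. d (x t)) \<and>
      (\<lambda>t. r (x (Suc t))) \<in> O(\<lambda>t. r (x t) powr (1 + s)) \<and>
      (\<lambda>t. d (x (Suc t))) \<in> O(\<lambda>t. d (x t) powr (1 + s))"
    if seq: "inexact_newton_sequence A DA B c \<nu> \<rho> \<theta> C J x" and start: "r (x 0) \<le> \<delta>" for x J
  proof -
    have half_le: "\<delta> * (1 / 2) ^ t \<le> \<delta>" for t
      using mult_left_mono[OF power_le_one, of "1 / 2" \<delta> t] \<delta>(1) by simp
    \<comment> \<open>The geometric bound also carries the invariant
      \<open>r (x t) \<le> \<delta>\<close>, without which the one-step estimate could not be
      applied at the next index.\<close>
    have geom: "r (x t) \<le> \<delta> * (1 / 2) ^ t" for t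
    proof (induction t)
      case (Suc t)
      then have le: "r (x t) \<le> \<delta>"
        using half_le by (rule order_trans)
      have "r (x (Suc t)) \<le> r (x t) / 2"
        using step(1)[OF seq le] \<eta>(2)[of "r (x t)"] le \<delta> residual_nonneg[of "x t"] by linarith
      with Suc show ?case by simp
    qed (use start in simp)
    have le: "r (x t) \<le> \<delta>" for t
      using geom half_le by (rule order_trans)
    have geom0: "(\<lambda>t. \<delta> * (1 / 2 :: real) ^ t) \<longlonglongrightarrow> 0"
      using LIMSEQ_power_zero[of "1 / 2 :: real"] tendsto_mult_right_zero by fastforce
    have r0: "(\<lambda>t. r (x t)) \<longlonglongrightarrow> 0"
      by (rule tendsto_sandwich[OF _ _ tendsto_const geom0]) (auto simp: residual_nonneg geom)
    have "(\<lambda>t. \<kappa> * r (x t) powr q) \<longlonglongrightarrow> \<kappa> * 0"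
      using q_pos residual_nonneg
      by (intro tendsto_mult tendsto_const tendsto_zero_powrI[OF r0 tendsto_const]) auto
    then have d_bound0: "(\<lambda>t. \<kappa> * r (x t) powr q) \<longlonglongrightarrow> 0"
      by simp
    have d0: "(\<lambda>t. d (x t)) \<longlonglongrightarrow> 0"
    proof (rule tendsto_sandwich[OF _ _ tendsto_const d_bound0])
      show "\<forall>\<^sub>F t in sequentially. d (x t) \<le> \<kappa> * r (x t) powr q"
        using le \<delta>(3) order_trans by (intro always_eventually allI error_bound) blast
    qed (auto simp: infdist_nonneg)
    show ?thesis
      using Q_superlinear_to_zeroI[OF r0 residual_nonneg s step(1)[OF seq le]]
        Q_superlinear_to_zeroI[OF d0 infdist_nonneg s step(2)[OF seq le]]
        bigo_powr_of_nonneg_le[of "\<lambda>t. r (x t)", OF residual_nonneg step(1)[OF seq le]]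
        bigo_powr_of_nonneg_le[of "\<lambda>t. d (x t)", OF infdist_nonneg step(2)[OF seq le]]
      by blast
  qed
  with \<delta>(1) show "\<exists>\<delta>>0. \<forall>x J.
       inexact_newton_sequence A DA B c \<nu> \<rho> \<theta> C J x \<and> residual A B (x 0) \<le> \<delta> \<longrightarrow>
         Q_superlinear_to_zero (\<lambda>t. residual A B (x t)) \<and>
         Q_superlinear_to_zero (\<lambda>t. infdist (x t) (solution_set A B)) \<and>
         (\<lambda>t. residual A B (x (Suc t))) \<in> O(\<lambda>t. residual A B (x t) powr (1 + s)) \<and>
         (\<lambda>t. infdist (x (Suc t)) (solution_set A B))
           \<in> O(\<lambda>t. infdist (x t) (solution_set A B) powr (1 + s))"
    by blast
qed

end
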